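(* Let $x$ be real with $|x|<1$. For every index $\mathbf{k}$ (finite, possibly empty, sequence of positive integers) we have, in $\mathbb{R}[T]$, \[P^{(x)}(\mathbf{k};T)=\rho\Bigl(Z_\ast^{(x)}\bigl(\mathbf{k};T-\gamma-\psi(1+x)\bigr)\Bigr).\]
   Context: For an index $\mathbf{k}=(k_1,\ldots,k_r)$, integer $N\ge1$ and $0<t<1$, let $\zeta_N^{(x)}(\mathbf{k})=\sum_{0<m_1<\cdots<m_r<N}\prod_{i}(m_i+x)^{-k_i}$ and $\mathrm{Li}_\mathbf{k}^{(x)}(t)=\sum_{0<m_1<\cdots<m_r}t^{m_r+x}\prod_i(m_i+x)^{-k_i}$ (both $=1$ for $\mathbf{k}=\varnothing$). $Z_\ast^{(x)}(\mathbf{k};T)\in\mathbb{R}[T]$ is the unique polynomial with $\zeta_N^{(x)}(\mathbf{k})=Z_\ast^{(x)}(\mathbf{k};\log N-\psi(1+x))+O(N^{-1}\log^pN)$ as $N\to\infty$ for some $p>0$, and $P^{(x)}(\mathbf{k};T)\in\mathbb{R}[T]$ is the unique polynomial with $\mathrm{Li}_\mathbf{k}^{(x)}(t)=P^{(x)}(\mathbf{k};-\log(1-t))+O((1-t)\log^p(1-t))$ as $t\to1^-$ for some $p>0$ (these polynomials exist). Here $\psi=\Gamma'/\Gamma$ is the digamma function and $\gamma$ is Euler's constant. The map $\rho:\mathbb{R}[T]\to\mathbb{R}[T]$ is the $\mathbb{R}$-linear map defined by the identity $\rho(e^{Ty})=A(y)e^{Ty}$ in $\mathbb{R}[T][[y]]$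 ($\rho$ acting coefficientwise in $y$), where $A(y)=e^{\gamma y}\Gamma(1+y)=\exp\bigl(\sum_{n\ge2}\frac{(-1)^n}{n}\zeta(n)y^n\bigr)$; i.e. $\rho(T^n/n!)$ is the coefficient of $y^n$ in $A(y)e^{Ty}$. *)

theory Defs
  imports "HOL-Analysis.Analysis" "HOL-Computational_Algebra.Computational_Algebra"
    "HOL-Library.Landau_Symbols"
begin

definition incr_tuples :: "nat \<Rightarrow> nat set \<Rightarrow> nat list set" where
  "incr_tuples r S = {ms. length ms = r \<and> sorted_wrt (<) ms \<and> set ms \<subseteq> S}"

definition mz_term :: "real \<Rightarrow> nat list \<Rightarrow> nat list \<Rightarrow> real" where
  "mz_term x ks ms = (\<Prod>i<length ks. 1 / (real (ms ! i) + x) ^ (ks ! i))"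

definition zeta_trunc :: "real \<Rightarrow> nat list \<Rightarrow> nat \<Rightarrow> real" where
  "zeta_trunc x ks N = (\<Sum>ms\<in>incr_tuples (length ks) {0<..<N}. mz_term x ks ms)"

definition Li :: "real \<Rightarrow> nat list \<Rightarrow> real \<Rightarrow> real" where
  "Li x ks t = (if ks = [] then 1
     else (\<Sum>\<^sub>\<infinity>ms\<in>incr_tuples (length ks) {0<..}. t powr (real (last ms) + x) * mz_term x ks ms))"

definition Zstar :: "real \<Rightarrow> nat list \<Rightarrow> real poly" where
  "Zstar x ks = (THE Q. \<exists>p::nat. p > 0 \<and>
     (\<lambda>N. zeta_trunc x ks N - poly Q (ln (real N) - Digamma (1 + x)))
        \<in> O(\<lambda>N. ln (real N) ^ p / real N))"

definition Ppoly :: "real \<Rightarrow> nat list \<Rightarrow> real poly" where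
  "Ppoly x ks = (THE Q. \<exists>p::nat. p > 0 \<and>
     (\<lambda>t. Li x ks t - poly Q (- ln (1 - t)))
        \<in> O[at_left 1](\<lambda>t. (1 - t) * ln (1 - t) ^ p))"

text \<open>The Taylor series at \<open>0\<close> of \<open>y \<mapsto> exp (\<gamma> y) \<Gamma>(1 + y)\<close>.\<close>
definition A_fps :: "real fps" where
  "A_fps = Abs_fps (\<lambda>n. (deriv ^^ n) (\<lambda>y. exp (euler_mascheroni * y) * Gamma (1 + y)) 0 / fact n)"

text \<open>The series \<open>e\<^sup>T\<^sup>y\<close> in \<open>\<real>[T][[y]]\<close>.\<close>
definition exp_Ty :: "real poly fps" where
  "exp_Ty = Abs_fps (\<lambda>n. monom (1 / fact n) n)"

definition A_exp_Ty :: "real poly fps" where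
  "A_exp_Ty = Abs_fps (\<lambda>n. [:fps_nth A_fps n:]) * exp_Ty"

text \<open>The linear extension of \<open>T\<^sup>n / n! \<mapsto> [y\<^sup>n] (A(y) e\<^sup>T\<^sup>y)\<close>; the lemmas below confirm
  linearity and the identity \<open>\<rho>(e\<^sup>T\<^sup>y) = A(y) e\<^sup>T\<^sup>y\<close>, which together determine \<open>\<rho>\<close>.\<close>
definition rho :: "real poly \<Rightarrow> real poly" where
  "rho f = (\<Sum>n\<le>degree f. smult (coeff f n * fact n) (fps_nth A_exp_Ty n))"

lemma rho_altdef:
  assumes "degree f \<le> d"
  shows "rho f = (\<Sum>n\<le>d. smult (coeff f n * fact n) (fps_nth A_exp_Ty n))"
  unfolding rho_def using assms
  by (intro sum.mono_neutral_left) (auto simp: coeff_eq_0)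

lemma rho_add: "rho (f + g) = rho f + rho g"
proof -
  let ?d = "max (degree f) (degree g)"
  have "degree (f + g) \<le> ?d"
    by (rule degree_add_le_max)
  then show ?thesis
    by (simp add: rho_altdef[of _ ?d] smult_add_left ring_distribs flip: sum.distrib)
qed

lemma smult_sum_right: "smult c (\<Sum>i\<in>I. g i) = (\<Sum>i\<in>I. smult c (g i))"
  by (induction I rule: infinite_finite_induct) (auto simp: smult_add_right)

lemma rho_smult: "rho (smult c f) = smult c (rho f)"
  by (simp add: rho_altdef[OF degree_smult_le] smult_sum_right mult_ac)
    (simp add: rho_def smult_sum_right mult_ac)

lemma rho_exp_Ty: "Abs_fps (\<lambda>n. rho (fps_nth exp_Ty n)) = A_exp_Ty"
proof (rule fps_ext)
  fix n
  have "rho (monom (1 / fact n) n) =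
      (\<Sum>k\<le>n. if k = n then fps_nth A_exp_Ty n else 0)"
    unfolding rho_altdef[OF degree_monom_le] by (rule sum.cong) auto
  then show "fps_nth (Abs_fps (\<lambda>n. rho (fps_nth exp_Ty n))) n = fps_nth A_exp_Ty n"
    by (simp add: exp_Ty_def)
qed

end

theory Submission
  imports Defs "HOL-Real_Asymp.Real_Asymp"
begin

text \<open>Summation by parts gives \<open>Li(t) = t\<^bsup>x - 1\<^esup> (1 - t) \<Sum>\<^sub>N \<zeta>\<^sub>N t\<^sup>N\<close>, so only the Abel means of
  \<open>(log N + \<gamma>)\<^sup>n\<close> are needed. Put \<open>T = - log (1 - t)\<close>. Since
  \<open>\<Sum>\<^sub>N \<Prod>\<^sub>j\<^sub>\<le>\<^sub>N (1 + y / j) t\<^sup>N = (1 - t)\<^bsup>- 1 - y\<^esup>\<close>, the Abel mean of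
  \<open>N \<mapsto> \<Prod>\<^sub>j\<^sub>\<le>\<^sub>N (1 + y / j)\<close> is exactly \<open>exp (T y)\<close>, coefficientwise in \<open>y\<close>. On the other hand
  \<open>A(y) \<Prod>\<^sub>j\<^sub>\<le>\<^sub>N (1 + y / j) = exp ((log N + \<gamma>) y)\<close> up to an error of order \<open>log\<^sup>p N / N\<close> in every
  coefficient. Hence Abel means turn \<open>exp ((log N + \<gamma>) y)\<close> into \<open>A(y) exp (T y)\<close>, which is the
  definition of \<open>\<rho>\<close>. The expansion of \<open>\<zeta>\<^sub>N\<close> itself comes by induction on the index, summing
  \<open>log\<^sup>j N / N\<close>.\<close>

unbundle no vec_syntax
unbundle fps_syntax

section \<open>Landau classes up to powers of a logarithm\<close>

locale log_scale =
  fixes F :: "'a filter" and L :: "'a \<Rightarrow> real"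
  assumes neq_bot: "F \<noteq> bot" and scale_at_infinity: "filterlim L at_infinity F"
begin

definition soft_bigo :: "('a \<Rightarrow> real) \<Rightarrow> ('a \<Rightarrow> real) set" where
  "soft_bigo g = (\<Union>p. O[F](\<lambda>u. g u * L u ^ p))"

lemma power_bigo_mono:
  assumes "p \<le> q"
  shows "(\<lambda>u. L u ^ p) \<in> O[F](\<lambda>u. L u ^ q)"
proof (rule bigoI[of _ 1])
  have "\<forall>\<^sub>F u in F. 1 \<le> norm (L u)"
    using scale_at_infinity filterlim_at_infinity[of 0 L F] by simp
  then show "\<forall>\<^sub>F u in F. norm (L u ^ p) \<le> 1 * norm (L u ^ q)"
    by eventually_elim (use assms in \<open>simp add: power_abs power_increasing\<close>)
qed

lemma soft_bigoI: "f \<in> O[F](\<lambda>u. g u * L u ^ p) \<Longrightarrow> f \<in> soft_bigo g"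
  unfolding soft_bigo_def by blast

lemma soft_bigoE:
  assumes "f \<in> soft_bigo g"
  obtains p where "\<forall>q\<ge>p. f \<in> O[F](\<lambda>u. g u * L u ^ q)"
proof -
  obtain p where p: "f \<in> O[F](\<lambda>u. g u * L u ^ p)"
    using assms unfolding soft_bigo_def by blast
  have "\<forall>q\<ge>p. f \<in> O[F](\<lambda>u. g u * L u ^ q)"
    using landau_o.big_trans[OF p landau_o.big.mult_left[OF power_bigo_mono]] by blast
  then show ?thesis by (rule that)
qed

lemma soft_bigo_iff_pos_power: "f \<in> soft_bigo g \<longleftrightarrow> (\<exists>p>0. f \<in> O[F](\<lambda>u. g u * L u ^ p))"
proof
  assume "f \<in> soft_bigo g"
  then obtain p where "\<forall>q\<ge>p. f \<in> O[F](\<lambda>u. g u * L u ^ q)" by (rule soft_bigoE)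
  then show "\<exists>p>0. f \<in> O[F](\<lambda>u. g u * L u ^ p)"
    by (intro exI[of _ "Suc p"]) (simp del: power_Suc)
qed (auto intro: soft_bigoI)

lemma bigo_imp_soft_bigo: "f \<in> O[F](g) \<Longrightarrow> f \<in> soft_bigo g"
  by (rule soft_bigoI[where p = 0]) simp

lemma const_in_soft_bigo [simp]: "(\<lambda>_. c) \<in> soft_bigo (\<lambda>_. 1)"
  by (rule bigo_imp_soft_bigo) simp

lemma scale_in_soft_bigo [simp]: "L \<in> soft_bigo (\<lambda>_. 1)"
  by (rule soft_bigoI[where p = 1]) simp

lemma soft_bigo_trans:
  assumes "f \<in> soft_bigo g" "g \<in> O[F](h)"
  shows "f \<in> soft_bigo h"
proof -
  obtain p where "f \<in> O[F](\<lambda>u. g u * L u ^ p)"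
    using assms(1) unfolding soft_bigo_def by blast
  also have "(\<lambda>u. g u * L u ^ p) \<in> O[F](\<lambda>u. h u * L u ^ p)"
    by (intro landau_o.big.mult_right assms(2))
  finally show ?thesis by (rule soft_bigoI)
qed

lemma bigo_soft_bigo_trans: "f \<in> O[F](g) \<Longrightarrow> g \<in> soft_bigo h \<Longrightarrow> f \<in> soft_bigo h"
  unfolding soft_bigo_def by (blast intro: landau_o.big_trans)

lemma soft_bigo_cong:
  assumes "f \<in> soft_bigo h" "\<forall>\<^sub>F u in F. f u = g u"
  shows "g \<in> soft_bigo h"
  using assms landau_o.big.in_cong[OF assms(2)] unfolding soft_bigo_def by blast

lemma soft_bigo_add:
  assumes "f \<in> soft_bigo h" "g \<in> soft_bigo h"
  shows "(\<lambda>u. f u + g u) \<in> soft_bigo h"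
proof -
  obtain p where p: "\<forall>r\<ge>p. f \<in> O[F](\<lambda>u. h u * L u ^ r)"
    using assms(1) by (rule soft_bigoE)
  obtain q where q: "\<forall>r\<ge>q. g \<in> O[F](\<lambda>u. h u * L u ^ r)"
    using assms(2) by (rule soft_bigoE)
  from p q show ?thesis
    by (intro soft_bigoI[where p = "max p q"] sum_in_bigo(1)) auto
qed

lemma soft_bigo_mult:
  assumes "f \<in> soft_bigo h\<^sub>1" "g \<in> soft_bigo h\<^sub>2"
  shows "(\<lambda>u. f u * g u) \<in> soft_bigo (\<lambda>u. h\<^sub>1 u * h\<^sub>2 u)"
proof -
  obtain p where p: "f \<in> O[F](\<lambda>u. h\<^sub>1 u * L u ^ p)"
    using assms(1) unfolding soft_bigo_def by blast
  obtain q where q: "g \<in> O[F](\<lambda>u. h\<^sub>2 u * L u ^ q)"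
    using assms(2) unfolding soft_bigo_def by blast
  have "(\<lambda>u. f u * g u) \<in> O[F](\<lambda>u. (h\<^sub>1 u * L u ^ p) * (h\<^sub>2 u * L u ^ q))"
    by (rule landau_o.big.mult[OF p q])
  also have "(\<lambda>u. (h\<^sub>1 u * L u ^ p) * (h\<^sub>2 u * L u ^ q)) = (\<lambda>u. h\<^sub>1 u * h\<^sub>2 u * L u ^ (p + q))"
    by (simp add: fun_eq_iff power_add)
  finally show ?thesis by (rule soft_bigoI)
qed

lemma soft_bigo_1_mult:
  "f \<in> soft_bigo (\<lambda>_. 1) \<Longrightarrow> g \<in> soft_bigo h \<Longrightarrow> (\<lambda>u. f u * g u) \<in> soft_bigo h"
  using soft_bigo_mult[of f "\<lambda>_. 1" g h] by simp

lemma bigo_mult_soft_bigo_1: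
  "f \<in> O[F](h) \<Longrightarrow> g \<in> soft_bigo (\<lambda>_. 1) \<Longrightarrow> (\<lambda>u. f u * g u) \<in> soft_bigo h"
  using soft_bigo_mult[OF bigo_imp_soft_bigo, of f h g "\<lambda>_. 1"] by simp

lemma soft_bigo_cmult: "f \<in> soft_bigo g \<Longrightarrow> (\<lambda>u. c * f u) \<in> soft_bigo g"
  by (rule soft_bigo_1_mult) simp_all

lemma soft_bigo_diff:
  assumes "f \<in> soft_bigo h" "g \<in> soft_bigo h"
  shows "(\<lambda>u. f u - g u) \<in> soft_bigo h"
  using soft_bigo_add[OF assms(1) soft_bigo_cmult[OF assms(2), of "- 1"]] by simp

lemma soft_bigo_sum:
  assumes "\<And>i. i \<in> I \<Longrightarrow> f i \<in> soft_bigo g"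
  shows "(\<lambda>u. \<Sum>i\<in>I. f i u) \<in> soft_bigo g"
  using assms
  by (induction I rule: infinite_finite_induct)
    (auto intro: soft_bigo_add bigo_imp_soft_bigo)

lemma soft_bigo_poly:
  assumes "f \<in> soft_bigo (\<lambda>_. 1)"
  shows "(\<lambda>u. poly Q (f u)) \<in> soft_bigo (\<lambda>_. 1)"
proof (induction Q)
  case (pCons a Q)
  then show ?case
    using soft_bigo_add[OF const_in_soft_bigo soft_bigo_1_mult[OF assms pCons.IH]] by simp
qed simp

lemma soft_bigo_1_if_poly_expansion:
  assumes "(\<lambda>u. f u - poly Q (l u)) \<in> soft_bigo g" "g \<in> O[F](\<lambda>_. 1)" "l \<in> soft_bigo (\<lambda>_. 1)"
  shows "f \<in> soft_bigo (\<lambda>_. 1)"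
  using soft_bigo_add[OF soft_bigo_trans[OF assms(1,2)] soft_bigo_poly[OF assms(3), of Q]] by simp

lemma poly_eq_0_if_tendsto_0:
  assumes "filterlim l at_infinity F" "((\<lambda>u. poly Q (l u)) \<longlongrightarrow> 0) F"
  shows "Q = (0 :: real poly)"
proof (cases "degree Q = 0")
  case True
  then obtain c where "Q = [:c:]" by (rule degree_eq_zeroE)
  with assms(2) neq_bot show ?thesis by (simp add: tendsto_const_iff)
next
  case False
  then have "filterlim (poly Q) at_infinity at_infinity"
    by (intro filterlim_poly_at_infinity) auto
  then have "filterlim (\<lambda>u. poly Q (l u)) at_infinity F"
    using assms(1) by (rule filterlim_compose)
  with assms(2) neq_bot show ?thesis by (blast dest: not_tendsto_and_filterlim_at_infinity)
qed

lemma the_poly_expansion: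
  assumes null: "\<And>p. ((\<lambda>u. g u * L u ^ p) \<longlongrightarrow> 0) F"
    and l: "filterlim l at_infinity F"
    and Q: "(\<lambda>u. f u - poly Q (l u)) \<in> soft_bigo g"
  shows "(THE Q. (\<lambda>u. f u - poly Q (l u)) \<in> soft_bigo g) = Q"
proof (rule the_equality[where P = "\<lambda>Q. (\<lambda>u. f u - poly Q (l u)) \<in> soft_bigo g", OF Q])
  fix R assume R: "(\<lambda>u. f u - poly R (l u)) \<in> soft_bigo g"
  obtain p where "(\<lambda>u. (f u - poly Q (l u)) - (f u - poly R (l u))) \<in> O[F](\<lambda>u. g u * L u ^ p)"
    using soft_bigo_diff[OF Q R] unfolding soft_bigo_def by blast
  also have "(\<lambda>u. g u * L u ^ p) \<in> o[F](\<lambda>_. 1)"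
    using null by (intro smalloI_tendsto) auto
  finally have "((\<lambda>u. poly (R - Q) (l u)) \<longlongrightarrow> 0) F"
    by (auto dest: smalloD_tendsto)
  then have "R - Q = 0" by (rule poly_eq_0_if_tendsto_0[OF l])
  then show "R = Q" by simp
qed

end

interpretation seq: log_scale sequentially "\<lambda>N. ln (real N)"
proof
  show "filterlim (\<lambda>N. ln (real N)) at_infinity sequentially" by real_asymp
qed simp

interpretation left: log_scale "at_left (1 :: real)" "\<lambda>t. ln (1 - t)"
proof
  show "filterlim (\<lambda>t::real. ln (1 - t)) at_infinity (at_left 1)" by real_asymp
qed simp

lemma eventually_at_left_1_in_unit_interval: "\<forall>\<^sub>F t in at_left (1 :: real). 0 < t \<and> t < 1"
  using eventually_at_left_real[OF zero_less_one] by eventually_elim simp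

lemma neg_ln_in_soft_bigo: "(\<lambda>t. - ln (1 - t)) \<in> left.soft_bigo (\<lambda>_. 1)"
  using left.soft_bigo_cmult[OF left.scale_in_soft_bigo, of "- 1"] by simp

section \<open>Summation of sequences with small differences\<close>

lemma tendsto_if_diff_le_telescoping:
  fixes f :: "nat \<Rightarrow> 'a :: banach"
  assumes diff_le: "\<forall>\<^sub>F n in sequentially. norm (f (Suc n) - f n) \<le> G n - G (Suc n)"
    and G: "G \<longlonglongrightarrow> 0"
  obtains c where "f \<longlonglongrightarrow> c" "\<forall>\<^sub>F n in sequentially. norm (f n - c) \<le> G n"
proof -
  have "summable (\<lambda>n. f (Suc n) - f n)"
    by (rule summable_comparison_test_ev[OF diff_le]) (rule telescope_summable'[OF G])
  then obtain s where "(\<lambda>n. \<Sum>k<n. f (Suc k) - f k) \<longlonglongrightarrow> s"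
    by (auto simp: summable_def sums_def)
  then have "(\<lambda>n. f n - f 0) \<longlonglongrightarrow> s" by (simp add: sum_lessThan_telescope)
  then have lim: "f \<longlonglongrightarrow> s + f 0" using tendsto_add[of _ s _ "\<lambda>_. f 0"] by fastforce
  obtain K where K: "\<And>n. n \<ge> K \<Longrightarrow> norm (f (Suc n) - f n) \<le> G n - G (Suc n)"
    using diff_le by (auto simp: eventually_sequentially)
  have "norm (f n - (s + f 0)) \<le> G n" if "n \<ge> K" for n
  proof -
    have diff_bound: "norm (f n - f m) \<le> G n - G m" if "m \<ge> n" for m
      using that
    proof (induction m rule: dec_induct)
      case (step m)
      have "norm (f n - f (Suc m)) \<le> norm (f n - f m) + norm (f (Suc m) - f m)"
        using norm_triangle_ineq4[of "f n - f m" "f (Suc m) - f m"] by simp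
      with step.IH K[of m] step.hyps \<open>n \<ge> K\<close> show ?case by simp
    qed simp
    have "(\<lambda>m. norm (f n - f m)) \<longlonglongrightarrow> norm (f n - (s + f 0))" by (intro tendsto_intros lim)
    moreover have "(\<lambda>m. G n - G m) \<longlonglongrightarrow> G n - 0" by (intro tendsto_intros G)
    ultimately show ?thesis
      using diff_bound by (intro LIMSEQ_le[of _ _ "\<lambda>m. G n - G m" "G n"]) auto
  qed
  then have "\<forall>\<^sub>F n in sequentially. norm (f n - (s + f 0)) \<le> G n"
    by (auto simp: eventually_sequentially)
  with lim show ?thesis by (rule that)
qed

text \<open>\<open>log\<^sup>p N / N\<close> telescopes the tails of \<open>\<Sum> log\<^sup>p N / N\<^sup>2\<close> up to a constant factor.\<close>

lemma tendsto_if_diff_soft_bigo: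
  assumes "(\<lambda>N. f (Suc N) - f N) \<in> seq.soft_bigo (\<lambda>N. 1 / real N ^ 2)"
  obtains c where "f \<longlonglongrightarrow> c" "(\<lambda>N. f N - c) \<in> seq.soft_bigo (\<lambda>N. 1 / real N)"
proof -
  obtain p where p: "(\<lambda>N. f (Suc N) - f N) \<in> O(\<lambda>N. 1 / real N ^ 2 * ln (real N) ^ p)"
    using assms unfolding seq.soft_bigo_def by blast
  define G where "G = (\<lambda>N. 1 / real N * ln (real N) ^ p)"
  have "(\<lambda>N. 1 / real N ^ 2 * ln (real N) ^ p) \<in> O(\<lambda>N. G N - G (Suc N))"
    unfolding G_def by real_asymp
  with p have "(\<lambda>N. f (Suc N) - f N) \<in> O(\<lambda>N. G N - G (Suc N))"
    by (rule landau_o.big_trans)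
  then obtain C where C: "C > 0"
    "\<forall>\<^sub>F N in sequentially. norm (f (Suc N) - f N) \<le> C * norm (G N - G (Suc N))"
    by (rule landau_o.bigE)
  have "\<forall>\<^sub>F N in sequentially. G (Suc N) \<le> G N" unfolding G_def by real_asymp
  with C(2) have "\<forall>\<^sub>F N in sequentially. norm (f (Suc N) - f N) \<le> C * G N - C * G (Suc N)"
    by eventually_elim (simp add: right_diff_distrib)
  moreover have "G \<longlonglongrightarrow> 0" unfolding G_def by real_asymp
  then have "(\<lambda>N. C * G N) \<longlonglongrightarrow> 0" by (rule tendsto_mult_right_zero)
  ultimately obtain c where c: "f \<longlonglongrightarrow> c" "\<forall>\<^sub>F N in sequentially. norm (f N - c) \<le> C * G N"
    by (rule tendsto_if_diff_le_telescoping)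
  from c(2) have "\<forall>\<^sub>F N in sequentially. norm (f N - c) \<le> C * norm (G N)"
    by eventually_elim (use C(1) in \<open>simp add: order_trans[OF _ mult_left_mono[OF abs_ge_self]]\<close>)
  then have "(\<lambda>N. f N - c) \<in> O(G)" by (rule bigoI)
  with c(1) show ?thesis unfolding G_def by (intro that seq.soft_bigoI)
qed

lemma soft_bigo_limit_if_diff:
  assumes "(\<lambda>N. f (Suc N) - f N) \<in> seq.soft_bigo (\<lambda>N. 1 / real N ^ 2)" "f \<longlonglongrightarrow> c"
  shows "(\<lambda>N. f N - c) \<in> seq.soft_bigo (\<lambda>N. 1 / real N)"
  using tendsto_if_diff_soft_bigo[OF assms(1)] LIMSEQ_unique[OF assms(2)] by metis

lemma poly_ln_Suc_diff:
  "(\<lambda>N. poly R (ln (real (Suc N))) - poly R (ln (real N)) - poly (pderiv R) (ln (real N)) / real N)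
    \<in> seq.soft_bigo (\<lambda>N. 1 / real N ^ 2)"
proof (induction R)
  case (pCons a R)
  let ?l = "\<lambda>N. ln (real N)"
  define d where "d = (\<lambda>N. ?l (Suc N) - ?l N)"
  have l_Suc: "(\<lambda>N. ?l (Suc N)) \<in> seq.soft_bigo (\<lambda>_. 1)"
    by (rule seq.soft_bigoI[where p = 1]) real_asymp
  have d_div: "(\<lambda>N. d N / real N) \<in> O(\<lambda>N. 1 / real N ^ 2)"
    unfolding d_def by real_asymp
  have d_approx: "(\<lambda>N. d N - 1 / real N) \<in> O(\<lambda>N. 1 / real N ^ 2)"
    unfolding d_def by real_asymp
  have "(\<lambda>N. ?l (Suc N) * (poly R (?l (Suc N)) - poly R (?l N) - poly (pderiv R) (?l N) / real N)
      + (d N - 1 / real N) * poly R (?l N) + d N / real N * poly (pderiv R) (?l N))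
    \<in> seq.soft_bigo (\<lambda>N. 1 / real N ^ 2)"
    by (intro seq.soft_bigo_add seq.soft_bigo_1_mult[OF l_Suc pCons.IH]
        seq.bigo_mult_soft_bigo_1[OF d_div] seq.bigo_mult_soft_bigo_1[OF d_approx]
        seq.soft_bigo_poly seq.scale_in_soft_bigo)
  then show ?case
    by (simp add: d_def pderiv_pCons algebra_simps add_divide_distrib diff_divide_distrib)
qed (simp add: seq.bigo_imp_soft_bigo)

lemma pderiv_surj: "\<exists>R. pderiv R = (Q :: 'a :: field_char_0 poly)"
proof
  let ?R = "Poly (map (\<lambda>i. coeff Q (i - 1) / of_nat i) [0..<degree Q + 2])"
  show "pderiv ?R = Q"
    by (rule poly_eqI)
      (auto simp: coeff_pderiv nth_default_def coeff_eq_0 simp del: of_nat_Suc upt_Suc)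
qed

lemma polynomial_expansion_if_diff:
  assumes "(\<lambda>N. f (Suc N) - f N - poly Q (ln (real N)) / real N)
    \<in> seq.soft_bigo (\<lambda>N. 1 / real N ^ 2)"
  shows "\<exists>R. (\<lambda>N. f N - poly R (ln (real N))) \<in> seq.soft_bigo (\<lambda>N. 1 / real N)"
proof -
  obtain R where "pderiv R = Q" using pderiv_surj by blast
  with seq.soft_bigo_diff[OF assms poly_ln_Suc_diff[of R]]
  have "(\<lambda>N. (f (Suc N) - poly R (ln (real (Suc N)))) - (f N - poly R (ln (real N))))
      \<in> seq.soft_bigo (\<lambda>N. 1 / real N ^ 2)"
    by (simp add: algebra_simps)
  then obtain c where "(\<lambda>N. f N - poly R (ln (real N)) - c) \<in> seq.soft_bigo (\<lambda>N. 1 / real N)"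
    by (rule tendsto_if_diff_soft_bigo)
  then show ?thesis by (intro exI[of _ "R + [:c:]"]) (simp add: algebra_simps)
qed

section \<open>Truncated sums\<close>

lemma finite_incr_tuples: "finite S \<Longrightarrow> finite (incr_tuples r S)"
  unfolding incr_tuples_def
  by (rule finite_subset[OF _ finite_lists_length_eq[of S r]]) auto

lemma bij_betw_incr_tuples_snoc:
  "bij_betw (\<lambda>(n, ms). ms @ [n]) (SIGMA n:S. incr_tuples r (S \<inter> {..<n})) (incr_tuples (Suc r) S)"
proof (rule bij_betwI[where g = "\<lambda>ms. (last ms, butlast ms)"])
  show "(\<lambda>(n, ms). ms @ [n]) \<in> (SIGMA n:S. incr_tuples r (S \<inter> {..<n})) \<rightarrow> incr_tuples (Suc r) S"
    by (auto simp: incr_tuples_def sorted_wrt_append)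
  show "(\<lambda>ms. (last ms, butlast ms)) \<in>
      incr_tuples (Suc r) S \<rightarrow> (SIGMA n:S. incr_tuples r (S \<inter> {..<n}))"
  proof
    fix ms assume ms: "ms \<in> incr_tuples (Suc r) S"
    then obtain ms' n where "ms = ms' @ [n]"
      by (auto simp: incr_tuples_def length_Suc_conv_rev)
    with ms show "(last ms, butlast ms) \<in> (SIGMA n:S. incr_tuples r (S \<inter> {..<n}))"
      by (auto simp: incr_tuples_def sorted_wrt_append)
  qed
qed (auto simp: incr_tuples_def intro!: append_butlast_last_id)

lemma sum_incr_tuples_snoc:
  assumes "finite S"
  shows "sum \<phi> (incr_tuples (Suc r) S) = (\<Sum>n\<in>S. \<Sum>ms\<in>incr_tuples r (S \<inter> {..<n}). \<phi> (ms @ [n]))"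
proof -
  have "sum \<phi> (incr_tuples (Suc r) S) =
      (\<Sum>(n, ms)\<in>(SIGMA n:S. incr_tuples r (S \<inter> {..<n})). \<phi> (ms @ [n]))"
    using sum.reindex_bij_betw[OF bij_betw_incr_tuples_snoc[of S r], of \<phi>]
    by (simp add: case_prod_unfold)
  then show ?thesis
    using assms by (simp add: sum.Sigma finite_incr_tuples)
qed

lemma has_sum_incr_tuples_snoc:
  fixes \<phi> :: "nat list \<Rightarrow> real"
  assumes nonneg: "\<And>ms. ms \<in> incr_tuples (Suc r) A \<Longrightarrow> \<phi> ms \<ge> 0"
    and sums: "((\<lambda>n. \<Sum>ms\<in>incr_tuples r (A \<inter> {..<n}). \<phi> (ms @ [n])) has_sum c) A"
  shows "(\<phi> has_sum c) (incr_tuples (Suc r) A)"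
proof -
  let ?I = "SIGMA n:A. incr_tuples r (A \<inter> {..<n})" and ?f = "\<lambda>(n, ms). \<phi> (ms @ [n])"
  have inner: "((\<lambda>ms. ?f (n, ms)) has_sum (\<Sum>ms\<in>incr_tuples r (A \<inter> {..<n}). \<phi> (ms @ [n])))
      (incr_tuples r (A \<inter> {..<n}))" for n
    by (simp add: finite_incr_tuples)
  have "?f summable_on ?I"
  proof (rule summable_on_SigmaI[OF inner])
    show "(\<lambda>n. \<Sum>ms\<in>incr_tuples r (A \<inter> {..<n}). \<phi> (ms @ [n])) summable_on A"
      using sums by (auto simp: summable_on_def)
    show "?f (n, ms) \<ge> 0" if "n \<in> A" "ms \<in> incr_tuples r (A \<inter> {..<n})" for n ms
      using bij_betwE[OF bij_betw_incr_tuples_snoc[of A r]] that nonneg by fastforce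
  qed
  then have "(?f has_sum c) ?I" by (intro has_sum_SigmaI[OF inner sums])
  then show ?thesis
    using has_sum_reindex_bij_betw[OF bij_betw_incr_tuples_snoc[of A r], of \<phi> c]
    by (simp add: case_prod_unfold)
qed

lemma mz_term_snoc:
  assumes "length ms = length ks"
  shows "mz_term x (ks @ [k]) (ms @ [n]) = mz_term x ks ms / (real n + x) ^ k"
  using assms by (simp add: mz_term_def nth_append)

lemma sum_mz_term_snoc:
  "(\<Sum>ms\<in>incr_tuples (length ks) {0<..<n}. mz_term x (ks @ [k]) (ms @ [n])) =
    zeta_trunc x ks n / (real n + x) ^ k"
  unfolding zeta_trunc_def sum_divide_distrib
  by (intro sum.cong) (auto simp: incr_tuples_def mz_term_snoc)

lemma mz_term_nonneg:
  assumes "x \<ge> -1" "ms \<in> incr_tuples (length ks) {0<..}"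
  shows "mz_term x ks ms \<ge> 0"
  unfolding mz_term_def
proof (intro prod_nonneg ballI divide_nonneg_nonneg zero_le_power)
  fix i assume "i \<in> {..<length ks}"
  then have "ms ! i \<in> {0<..}"
    using assms(2) by (auto simp: incr_tuples_def subset_iff)
  then have "real (ms ! i) \<ge> 1" by simp
  with assms(1) show "real (ms ! i) + x \<ge> 0" by linarith
qed simp

lemma zeta_trunc_Nil [simp]: "zeta_trunc x [] N = 1"
proof -
  have "incr_tuples 0 {0<..<N} = {[]}" by (auto simp: incr_tuples_def)
  then show ?thesis by (simp add: zeta_trunc_def mz_term_def)
qed

lemma zeta_trunc_nonneg: "x \<ge> -1 \<Longrightarrow> zeta_trunc x ks N \<ge> 0"
  unfolding zeta_trunc_def by (intro sum_nonneg mz_term_nonneg) (auto simp: incr_tuples_def)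

lemma zeta_trunc_snoc:
  "zeta_trunc x (ks @ [k]) N = (\<Sum>n\<in>{0<..<N}. zeta_trunc x ks n / (real n + x) ^ k)"
proof -
  have "{0<..<N} \<inter> {..<n} = {0<..<n}" if "n \<in> {0<..<N}" for n
    using that by auto
  then show ?thesis
    unfolding zeta_trunc_def[of x "ks @ [k]"]
    by (simp add: sum_incr_tuples_snoc flip: sum_mz_term_snoc)
qed

lemma zeta_trunc_snoc_diff:
  assumes "N \<ge> 1"
  shows "zeta_trunc x (ks @ [k]) (Suc N) - zeta_trunc x (ks @ [k]) N
    = zeta_trunc x ks N / (real N + x) ^ k"
proof -
  have "{0<..<Suc N} = insert N {0<..<N}" using assms by auto
  then show ?thesis by (simp add: zeta_trunc_snoc)
qed

lemma inverse_shifted_power_bigo: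
  assumes "k \<ge> 1"
  shows "(\<lambda>N. 1 / (real N + x) ^ k - of_bool (k = 1) / real N) \<in> O(\<lambda>N. 1 / real N ^ 2)"
proof (cases "k = 1")
  case True
  have "(\<lambda>N. 1 / (real N + x) - 1 / real N) \<in> O(\<lambda>N. 1 / real N ^ 2)" by real_asymp
  with True show ?thesis by simp
next
  case False
  have "(\<lambda>N. 1 / (real N + x) ^ k) \<in> O(\<lambda>N. 1 / real N ^ k)" by real_asymp
  also have "(\<lambda>N. 1 / real N ^ k) \<in> O(\<lambda>N. 1 / real N ^ 2)"
  proof (rule bigoI[of _ 1])
    show "\<forall>\<^sub>F N in sequentially. norm (1 / real N ^ k) \<le> 1 * norm (1 / real N ^ 2)"
      using eventually_ge_at_top[of 1]
      by eventually_elim (use False assms in \<open>auto intro!: divide_left_mono power_increasing\<close>)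
  qed
  finally show ?thesis using False by simp
qed

lemma zeta_trunc_expansion:
  assumes "\<forall>k\<in>set ks. k > 0"
  shows "\<exists>Q. (\<lambda>N. zeta_trunc x ks N - poly Q (ln (real N))) \<in> seq.soft_bigo (\<lambda>N. 1 / real N)"
  using assms
proof (induction ks rule: rev_induct)
  case Nil
  have "(\<lambda>N. zeta_trunc x [] N - poly 1 (ln (real N))) \<in> seq.soft_bigo (\<lambda>N. 1 / real N)"
    by (simp add: seq.bigo_imp_soft_bigo)
  then show ?case ..
next
  case (snoc k ks)
  then obtain Q where
    Q: "(\<lambda>N. zeta_trunc x ks N - poly Q (ln (real N))) \<in> seq.soft_bigo (\<lambda>N. 1 / real N)"
    by auto
  define c :: real where "c = of_bool (k = 1)"
  define rem where "rem = (\<lambda>N. 1 / (real N + x) ^ k - c / real N)"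
  have rem: "rem \<in> O(\<lambda>N. 1 / real N ^ 2)"
    unfolding rem_def c_def using snoc.prems by (intro inverse_shifted_power_bigo) auto
  have "(\<lambda>N. 1 / real N) \<in> O(\<lambda>_. 1)" by real_asymp
  from seq.soft_bigo_1_if_poly_expansion[OF Q this]
  have "(\<lambda>N. rem N * zeta_trunc x ks N) \<in> seq.soft_bigo (\<lambda>N. 1 / real N ^ 2)"
    by (intro seq.bigo_mult_soft_bigo_1[OF rem]) simp
  moreover have "(\<lambda>N. c / real N) \<in> seq.soft_bigo (\<lambda>N. 1 / real N)"
    by (intro seq.bigo_imp_soft_bigo) real_asymp
  from seq.soft_bigo_mult[OF this Q]
  have "(\<lambda>N. c / real N * (zeta_trunc x ks N - poly Q (ln (real N))))
      \<in> seq.soft_bigo (\<lambda>N. 1 / real N ^ 2)"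
    by (simp add: power2_eq_square)
  ultimately have "(\<lambda>N. rem N * zeta_trunc x ks N
      + c / real N * (zeta_trunc x ks N - poly Q (ln (real N))))
    \<in> seq.soft_bigo (\<lambda>N. 1 / real N ^ 2)"
    by (rule seq.soft_bigo_add)
  then have "(\<lambda>N. zeta_trunc x (ks @ [k]) (Suc N) - zeta_trunc x (ks @ [k]) N
      - poly (smult c Q) (ln (real N)) / real N) \<in> seq.soft_bigo (\<lambda>N. 1 / real N ^ 2)"
    by (rule seq.soft_bigo_cong)
      (use eventually_ge_at_top[of 1] in eventually_elim,
        simp add: zeta_trunc_snoc_diff rem_def algebra_simps)
  then show ?case by (rule polynomial_expansion_if_diff)
qed

section \<open>Taylor series and logarithmic derivatives\<close>

definition taylor_fps :: "('a \<Rightarrow> 'a) \<Rightarrow> 'a \<Rightarrow> 'a :: real_normed_field fps" where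
  "taylor_fps f a = Abs_fps (\<lambda>n. (deriv ^^ n) f a / fact n)"

lemma fps_deriv_taylor_fps_nth:
  assumes "((\<lambda>u. taylor_fps f u $ n) has_field_derivative D) (at y)"
  shows "fps_deriv (taylor_fps f y) $ n = D"
proof -
  have "((deriv ^^ n) f has_field_derivative fact n * D) (at y)"
    using DERIV_cmult[OF assms, of "fact n"] by (simp add: taylor_fps_def)
  then have "(deriv ^^ Suc n) f y = fact n * D" by (simp add: DERIV_imp_deriv)
  then show ?thesis by (simp add: taylor_fps_def del: of_nat_Suc)
qed

lemma has_field_derivative_fps_mult_nth:
  assumes "\<And>i. i \<le> n \<Longrightarrow> ((\<lambda>u. F u $ i) has_field_derivative F' $ i) (at y)"
    and "\<And>i. i \<le> n \<Longrightarrow> ((\<lambda>u. G u $ i) has_field_derivative G' $ i) (at y)"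
  shows "((\<lambda>u. (F u * G u) $ n) has_field_derivative (F' * G y + F y * G') $ n) (at y)"
proof -
  have "((\<lambda>u. \<Sum>i=0..n. F u $ i * G u $ (n - i)) has_field_derivative
      (\<Sum>i=0..n. F' $ i * G y $ (n - i) + G' $ (n - i) * F y $ i)) (at y)"
    by (intro DERIV_sum DERIV_mult assms) auto
  then show ?thesis
    by (simp add: fps_mult_nth sum.distrib mult.commute[of "G' $ _"])
qed

text \<open>The assumption on \<open>\<Psi>\<close> says that \<open>\<Psi> y\<close> is the Taylor series at \<open>y\<close> of a fixed function, namely
  the logarithmic derivative of \<open>f\<close>: varying \<open>y\<close> then acts on coefficients as \<open>fps_deriv\<close>.\<close>

lemma has_field_derivative_taylor_fps_nth_if_logderiv:
  assumes S: "open S"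
    and \<Psi>: "\<And>n y. y \<in> S \<Longrightarrow> ((\<lambda>u. \<Psi> u $ n) has_field_derivative fps_deriv (\<Psi> y) $ n) (at y)"
    and f: "\<And>y. y \<in> S \<Longrightarrow> (f has_field_derivative \<Psi> y $ 0 * f y) (at y)"
    and y: "y \<in> S"
  shows "((\<lambda>u. taylor_fps f u $ n) has_field_derivative (\<Psi> y * taylor_fps f y) $ n) (at y)"
  using y
proof (induction n arbitrary: y rule: less_induct)
  case (less n)
  define T where "T = taylor_fps f"
  note IH = less.IH[folded T_def]
  show ?case
  proof (cases n)
    case 0
    then show ?thesis using f[OF less.prems] by (simp add: taylor_fps_def)
  next
    case (Suc m)
    have deriv_T: "fps_deriv (T u) $ i = (\<Psi> u * T u) $ i" if "i \<le> m" "u \<in> S" for i u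
      unfolding T_def by (rule fps_deriv_taylor_fps_nth[OF less.IH]) (use that Suc in auto)
    have "((\<lambda>u. (\<Psi> u * T u) $ m) has_field_derivative
        (fps_deriv (\<Psi> y) * T y + \<Psi> y * fps_deriv (T y)) $ m) (at y)"
      using less.prems IH Suc
      by (intro has_field_derivative_fps_mult_nth \<Psi>) (simp_all only: deriv_T less_Suc_eq_le)
    then have "((\<lambda>u. (\<Psi> u * T u) $ m / of_nat n) has_field_derivative
        fps_deriv (\<Psi> y * T y) $ m / of_nat n) (at y)"
      by (intro DERIV_cdivide) (simp add: add.commute)
    also have "fps_deriv (\<Psi> y * T y) $ m / of_nat n = (\<Psi> y * T y) $ n"
      by (simp add: Suc del: of_nat_Suc fps_deriv_mult)
    finally have "((\<lambda>u. T u $ n) has_field_derivative (\<Psi> y * T y) $ n) (at y)"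
    proof (rule has_field_derivative_transform_within_open[OF _ S less.prems])
      show "(\<Psi> u * T u) $ m / of_nat n = T u $ n" if "u \<in> S" for u
        using deriv_T[OF order_refl that] by (simp add: Suc field_simps del: of_nat_Suc)
    qed
    then show ?thesis by (simp only: T_def)
  qed
qed

lemma fps_deriv_taylor_fps_if_logderiv:
  assumes "open S"
    and "\<And>n y. y \<in> S \<Longrightarrow> ((\<lambda>u. \<Psi> u $ n) has_field_derivative fps_deriv (\<Psi> y) $ n) (at y)"
    and "\<And>y. y \<in> S \<Longrightarrow> (f has_field_derivative \<Psi> y $ 0 * f y) (at y)"
    and "y \<in> S"
  shows "fps_deriv (taylor_fps f y) = \<Psi> y * taylor_fps f y"
  by (intro fps_ext fps_deriv_taylor_fps_nth
      has_field_derivative_taylor_fps_nth_if_logderiv[OF assms])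

lemma fps_deriv_prod_if_logderiv:
  fixes f g :: "'i \<Rightarrow> 'a :: comm_ring_1 fps"
  assumes "\<And>i. i \<in> I \<Longrightarrow> fps_deriv (f i) = g i * f i"
  shows "fps_deriv (\<Prod>i\<in>I. f i) = (\<Sum>i\<in>I. g i) * (\<Prod>i\<in>I. f i)"
  using assms by (induction I rule: infinite_finite_induct) (simp_all add: algebra_simps)

lemma (in log_scale) fps_nth_minus_exp_soft_bigo:
  fixes G \<Psi> :: "'a \<Rightarrow> real fps"
  assumes deriv: "\<And>u. fps_deriv (G u) = \<Psi> u * G u" and G_0: "\<And>u. G u $ 0 = 1"
    and l: "l \<in> soft_bigo (\<lambda>_. 1)" and g: "g \<in> O[F](\<lambda>_. 1)"
    and \<Psi>: "\<And>k. (\<lambda>u. (\<Psi> u - fps_const (l u)) $ k) \<in> soft_bigo g"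
  shows "(\<lambda>u. (G u - fps_exp (l u)) $ n) \<in> soft_bigo g"
proof (induction n rule: less_induct)
  case (less n)
  define E where "E = (\<lambda>u. G u - fps_exp (l u))"
  define \<Delta> where "\<Delta> = (\<lambda>u. \<Psi> u - fps_const (l u))"
  have E: "(\<lambda>u. E u $ i) \<in> soft_bigo g" if "i < n" for i
    using less[OF that] by (simp add: E_def)
  have G: "(\<lambda>u. G u $ i) \<in> soft_bigo (\<lambda>_. 1)" if "i < n" for i
  proof (rule soft_bigo_1_if_poly_expansion[OF _ g l])
    show "(\<lambda>u. G u $ i - poly (monom (1 / fact i) i) (l u)) \<in> soft_bigo g"
      using E[OF that] by (simp add: E_def poly_monom)
  qed
  show ?case
  proof (cases n)
    case 0
    then show ?thesis by (simp add: G_0 bigo_imp_soft_bigo)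
  next
    case (Suc m)
    have "fps_deriv (E u) = G u * \<Delta> u + fps_const (l u) * E u" for u
      by (simp add: E_def \<Delta>_def deriv algebra_simps)
    from arg_cong[OF this, of "\<lambda>D. D $ m"]
    have "real n * E u $ n = (\<Sum>i=0..m. G u $ i * \<Delta> u $ (m - i)) + l u * E u $ m" for u
      by (simp add: Suc fps_mult_nth[of "G u" "\<Delta> u"])
    then have "E u $ n = 1 / real n *
        ((\<Sum>i=0..m. G u $ i * \<Delta> u $ (m - i)) + l u * E u $ m)" for u
      by (simp add: Suc field_simps del: of_nat_Suc)
    moreover have "(\<lambda>u. 1 / real n *
        ((\<Sum>i=0..m. G u $ i * \<Delta> u $ (m - i)) + l u * E u $ m)) \<in> soft_bigo g"
      unfolding \<Delta>_def
      by (intro soft_bigo_cmult soft_bigo_add soft_bigo_sum soft_bigo_1_mult G E l \<Psi>)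
        (auto simp: Suc)
    ultimately show ?thesis by (simp add: E_def)
  qed
qed

section \<open>The Gamma factor and harmonic products\<close>

definition A_logderiv :: "real \<Rightarrow> real fps" where
  "A_logderiv y = fps_const euler_mascheroni + Abs_fps (\<lambda>k. Polygamma k (1 + y) / fact k)"

lemma fps_deriv_A_fps: "fps_deriv A_fps = A_logderiv 0 * A_fps"
proof -
  define f :: "real \<Rightarrow> real" where "f = (\<lambda>y. exp (euler_mascheroni * y) * Gamma (1 + y))"
  have not_pole: "1 + y \<notin> \<int>\<^sub>\<le>\<^sub>0" if "y \<in> {-1<..}" for y :: real
    using that by (auto elim!: nonpos_Ints_cases)
  have "fps_deriv (taylor_fps f 0) = A_logderiv 0 * taylor_fps f 0"
  proof (rule fps_deriv_taylor_fps_if_logderiv[where S = "{-1<..}"])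
    fix y :: real assume y: "y \<in> {-1<..}"
    show "((\<lambda>u. A_logderiv u $ n) has_field_derivative fps_deriv (A_logderiv y) $ n) (at y)" for n
      unfolding A_logderiv_def
      by (auto intro!: derivative_eq_intros not_pole[OF y] simp del: of_nat_Suc)
    show "(f has_field_derivative A_logderiv y $ 0 * f y) (at y)"
      unfolding f_def A_logderiv_def using not_pole[OF y]
      by (auto intro!: derivative_eq_intros simp: algebra_simps)
  qed auto
  then show ?thesis by (simp add: A_fps_def taylor_fps_def f_def)
qed

lemma A_fps_nth_0: "A_fps $ 0 = 1"
  by (simp add: A_fps_def)

text \<open>The coefficients of \<open>\<Prod>\<^sub>j\<^sub>\<le>\<^sub>N (1 + y / j)\<close> are the elementary symmetric functions of
  \<open>1, 1/2, \<dots>, 1/N\<close>; those of its logarithmic derivative are, up to sign, the power sums.\<close>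

definition harm_fps :: "nat \<Rightarrow> real fps" where
  "harm_fps N = (\<Prod>j=1..N. 1 + fps_const (1 / real j) * fps_X)"

definition harm_logderiv :: "nat \<Rightarrow> real fps" where
  "harm_logderiv N = (\<Sum>j=1..N. Abs_fps (\<lambda>k. (-1) ^ k / real j ^ Suc k))"

lemma harm_fps_0: "harm_fps 0 = 1"
  by (simp add: harm_fps_def)

lemma harm_fps_Suc: "harm_fps (Suc N) = (1 + fps_const (1 / real (Suc N)) * fps_X) * harm_fps N"
  by (simp add: harm_fps_def mult.commute)

lemma harm_fps_nth_Suc_Suc:
  "harm_fps (Suc N) $ Suc n = harm_fps N $ Suc n + harm_fps N $ n / real (Suc N)"
  by (simp add: harm_fps_Suc distrib_right mult.assoc)

lemma harm_fps_nth_0 [simp]: "harm_fps N $ 0 = 1"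
  by (induction N) (simp_all add: harm_fps_0 harm_fps_Suc)

lemma fps_deriv_harm_fps: "fps_deriv (harm_fps N) = harm_logderiv N * harm_fps N"
  unfolding harm_fps_def harm_logderiv_def
proof (rule fps_deriv_prod_if_logderiv, rule fps_ext)
  fix j n
  let ?q = "Abs_fps (\<lambda>k. (-1) ^ k / real j ^ Suc k)"
  have "?q * (1 + fps_const (1 / real j) * fps_X) = ?q + fps_const (1 / real j) * (fps_X * ?q)"
    by (simp add: algebra_simps)
  then show "fps_deriv (1 + fps_const (1 / real j) * fps_X) $ n =
      (?q * (1 + fps_const (1 / real j) * fps_X)) $ n"
    by (cases n) simp_all
qed

lemma harm_minus_ln_soft_bigo:
  "(\<lambda>N. harm N - (ln (real N) + euler_mascheroni)) \<in> seq.soft_bigo (\<lambda>N. 1 / real N)"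
proof -
  have "(\<lambda>N. 1 / real (Suc N) - (ln (real (Suc N)) - ln (real N))) \<in> O(\<lambda>N. 1 / real N ^ 2)"
    by real_asymp
  then have "(\<lambda>N. (harm (Suc N) - ln (real (Suc N))) - (harm N - ln (real N)))
      \<in> seq.soft_bigo (\<lambda>N. 1 / real N ^ 2)"
    by (intro seq.bigo_imp_soft_bigo) (simp add: harm_Suc inverse_eq_divide algebra_simps)
  from soft_bigo_limit_if_diff[OF this euler_mascheroni_LIMSEQ] show ?thesis
    by (simp add: algebra_simps)
qed

lemma power_sum_minus_Polygamma_soft_bigo:
  assumes "k \<ge> 1"
  shows "(\<lambda>N. (\<Sum>j=1..N. 1 / real j ^ Suc k) - (-1) ^ Suc k * Polygamma k 1 / fact k)
    \<in> seq.soft_bigo (\<lambda>N. 1 / real N)"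
proof (rule soft_bigo_limit_if_diff)
  have "(\<lambda>j. 1 / real (Suc j) ^ Suc k) sums ((-1) ^ Suc k * Polygamma k 1 / fact k)"
    using Polygamma_LIMSEQ[of "1::real" k] assms by (simp add: inverse_eq_divide add.commute)
  then show "(\<lambda>N. \<Sum>j=1..N. 1 / real j ^ Suc k) \<longlonglongrightarrow> (-1) ^ Suc k * Polygamma k 1 / fact k"
    by (simp add: sums_def sum.atLeast1_atMost_eq)
  show "(\<lambda>N. (\<Sum>j=1..Suc N. 1 / real j ^ Suc k) - (\<Sum>j=1..N. 1 / real j ^ Suc k))
      \<in> seq.soft_bigo (\<lambda>N. 1 / real N ^ 2)"
    using inverse_shifted_power_bigo[of "Suc k" 1] assms
    by (intro seq.bigo_imp_soft_bigo) (simp add: add.commute)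
qed

lemma logderiv_minus_ln_soft_bigo:
  "(\<lambda>N. (A_logderiv 0 + harm_logderiv N - fps_const (ln (real N) + euler_mascheroni)) $ k)
    \<in> seq.soft_bigo (\<lambda>N. 1 / real N)"
proof (cases "k = 0")
  case True
  then show ?thesis
    using harm_minus_ln_soft_bigo
    by (simp add: A_logderiv_def harm_logderiv_def harm_def fps_sum_nth inverse_eq_divide
        algebra_simps)
next
  case False
  have "(-1) ^ k * ((\<Sum>j=1..N. 1 / real j ^ Suc k) - (-1) ^ Suc k * Polygamma k 1 / fact k) =
      (A_logderiv 0 + harm_logderiv N - fps_const (ln (real N) + euler_mascheroni)) $ k" for N
    using False by (simp add: A_logderiv_def harm_logderiv_def fps_sum_nth algebra_simps
        sum_distrib_left flip: power_mult_distrib)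
  then show ?thesis
    using seq.soft_bigo_cmult[OF power_sum_minus_Polygamma_soft_bigo[of k], of "(-1) ^ k"] False
    by simp
qed

definition A_harm_fps :: "nat \<Rightarrow> real fps" where
  "A_harm_fps N = A_fps * harm_fps N"

lemma A_harm_fps_nth: "A_harm_fps N $ n = (\<Sum>j=0..n. A_fps $ j * harm_fps N $ (n - j))"
  by (simp add: A_harm_fps_def fps_mult_nth)

text \<open>\<open>A(y) \<Prod>\<^sub>j\<^sub>\<le>\<^sub>N (1 + y / j) = exp (\<gamma> y) \<Gamma>(N + 1 + y) / N!\<close>, which Stirling's
  formula compares with \<open>exp ((log N + \<gamma>) y)\<close>.\<close>

lemma A_harm_fps_expansion:
  "(\<lambda>N. A_harm_fps N $ n - (ln (real N) + euler_mascheroni) ^ n / fact n)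
    \<in> seq.soft_bigo (\<lambda>N. 1 / real N)"
proof -
  have "(\<lambda>N. (A_harm_fps N - fps_exp (ln (real N) + euler_mascheroni)) $ n)
      \<in> seq.soft_bigo (\<lambda>N. 1 / real N)"
  proof (rule seq.fps_nth_minus_exp_soft_bigo[OF _ _ _ _ logderiv_minus_ln_soft_bigo])
    show "fps_deriv (A_harm_fps N) = (A_logderiv 0 + harm_logderiv N) * A_harm_fps N" for N
      by (simp add: A_harm_fps_def fps_deriv_A_fps fps_deriv_harm_fps algebra_simps)
    show "(\<lambda>N. 1 / real N) \<in> O(\<lambda>_. 1)" by real_asymp
  qed (simp_all add: A_harm_fps_def A_fps_nth_0 seq.soft_bigo_add)
  then show ?thesis by simp
qed

section \<open>Generating functions of harmonic products\<close>

definition neg_ln_fps :: "real fps" where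
  "neg_ln_fps = Abs_fps (\<lambda>k. 1 / real k)"

definition neg_ln_power_fps :: "nat \<Rightarrow> real fps" where
  "neg_ln_power_fps n = fps_const (1 / fact n) * neg_ln_fps ^ n"

lemma neg_ln_power_fps_nth_0: "neg_ln_power_fps n $ 0 = (if n = 0 then 1 else 0)"
  by (simp add: neg_ln_power_fps_def neg_ln_fps_def)

lemma fps_deriv_neg_ln_power_fps:
  "fps_deriv (neg_ln_power_fps (Suc n)) = neg_ln_power_fps n * inverse (1 - fps_X)"
proof -
  have "fps_deriv neg_ln_fps = inverse (1 - fps_X)"
    by (simp add: fps_eq_iff neg_ln_fps_def fps_inverse_one_minus_fps_X del: of_nat_Suc)
  moreover have "fps_const (1 / fact (Suc n)) * of_nat (Suc n) = fps_const (1 / fact n :: real)"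
    by (simp flip: fps_of_nat del: of_nat_Suc)
  moreover have "fps_deriv (neg_ln_power_fps (Suc n)) =
      (fps_const (1 / fact (Suc n)) * of_nat (Suc n)) * (neg_ln_fps ^ n * fps_deriv neg_ln_fps)"
    unfolding neg_ln_power_fps_def fps_deriv_mult_const_left fps_deriv_power' diff_Suc_1
    by (simp only: mult_ac)
  ultimately show ?thesis
    by (simp only: neg_ln_power_fps_def mult.assoc)
qed

lemma less_fps_conv_radiusI:
  fixes f :: "real fps" and t :: real
  assumes "\<And>u. \<bar>u\<bar> < 1 \<Longrightarrow> summable (\<lambda>n. f $ n * u ^ n)" "\<bar>t\<bar> < 1"
  shows "ereal \<bar>t\<bar> < fps_conv_radius f"
proof -
  obtain u where "\<bar>t\<bar> < u" "u < 1" using dense[OF assms(2)] by blast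
  moreover from this have "ereal (norm u) \<le> fps_conv_radius f"
    unfolding fps_conv_radius_def by (intro conv_radius_geI assms(1)) auto
  ultimately show ?thesis by (simp add: less_le_trans[of _ "ereal u"])
qed

lemma neg_ln_fps_sums:
  assumes "\<bar>t\<bar> < 1"
  shows "(\<lambda>n. neg_ln_fps $ n * t ^ n) sums - ln (1 - t)"
  using sums_minus[OF ln_series'[of "- t"]] assms by (simp add: neg_ln_fps_def)

lemma less_conv_radius_neg_ln_fps:
  assumes "\<bar>t\<bar> < 1"
  shows "ereal \<bar>t\<bar> < fps_conv_radius neg_ln_fps"
  by (rule less_fps_conv_radiusI[OF sums_summable[OF neg_ln_fps_sums] assms])

lemma less_conv_radius_neg_ln_power_fps:
  assumes "\<bar>t\<bar> < 1"
  shows "ereal \<bar>t\<bar> < fps_conv_radius (neg_ln_power_fps n)"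
  using less_le_trans[OF less_conv_radius_neg_ln_fps[OF assms] fps_conv_radius_power[of _ n]]
  by (simp add: neg_ln_power_fps_def fps_conv_radius_cmult_left)

lemma eval_neg_ln_power_fps:
  assumes "\<bar>t\<bar> < 1"
  shows "eval_fps (neg_ln_power_fps n) t = (- ln (1 - t)) ^ n / fact n"
proof -
  note conv = less_conv_radius_neg_ln_fps[OF assms]
  have "eval_fps neg_ln_fps t = - ln (1 - t)"
    using neg_ln_fps_sums[OF assms] by (simp add: eval_fps_def sums_iff)
  then show ?thesis
    using less_le_trans[OF conv fps_conv_radius_power[of _ n]] conv
    by (simp add: neg_ln_power_fps_def eval_fps_mult eval_fps_power)
qed

text \<open>The coefficient of \<open>y\<^sup>n\<close> in \<open>\<Sum>\<^sub>N \<Prod>\<^sub>j\<^sub>\<le>\<^sub>N (1 + y / j) t\<^sup>N = (1 - t)\<^bsup>- 1 - y\<^esup>\<close>.\<close>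

lemma harm_fps_gf: "Abs_fps (\<lambda>N. harm_fps N $ n) = neg_ln_power_fps n * inverse (1 - fps_X)"
proof (induction n)
  case 0
  then show ?case
    by (simp add: neg_ln_power_fps_def fps_inverse_one_minus_fps_X)
next
  case (Suc n)
  define E where "E = Abs_fps (\<lambda>N. harm_fps N $ Suc n)"
  have "((1 - fps_X) * E) $ Suc N = harm_fps N $ n / real (Suc N)" for N
    by (simp add: E_def left_diff_distrib harm_fps_nth_Suc_Suc)
  then have "fps_deriv ((1 - fps_X) * E) $ N = harm_fps N $ n" for N
    by (simp del: fps_deriv_mult of_nat_Suc)
  then have "fps_deriv ((1 - fps_X) * E) = fps_deriv (neg_ln_power_fps (Suc n))"
    unfolding fps_deriv_neg_ln_power_fps Suc.IH[symmetric] by (intro fps_ext) simp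
  moreover have "((1 - fps_X) * E) $ 0 = neg_ln_power_fps (Suc n) $ 0"
    by (simp add: E_def neg_ln_power_fps_nth_0 harm_fps_0)
  ultimately have "(1 - fps_X) * E = neg_ln_power_fps (Suc n)"
    by (simp only: fps_deriv_eq_iff) simp
  moreover have "E = E * ((1 - fps_X) * inverse (1 - fps_X))"
    by (simp add: inverse_mult_eq_1')
  ultimately have "E = neg_ln_power_fps (Suc n) * inverse (1 - fps_X)"
    by (metis mult.assoc mult.commute)
  then show ?case by (simp only: E_def)
qed

lemma harm_fps_sums:
  assumes t: "\<bar>t\<bar> < 1"
  shows "(\<lambda>N. harm_fps N $ n * t ^ N) sums ((- ln (1 - t)) ^ n / fact n / (1 - t))"
proof -
  let ?q = "inverse (1 - fps_X) :: real fps"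
  have q: "(\<lambda>N. ?q $ N * u ^ N) sums (1 / (1 - u))" if "\<bar>u\<bar> < 1" for u
    using geometric_sums[of u] that by (simp add: fps_inverse_one_minus_fps_X)
  have conv_q: "ereal \<bar>t\<bar> < fps_conv_radius ?q"
    using q t by (intro less_fps_conv_radiusI) (auto simp: sums_iff)
  have "ereal \<bar>t\<bar> < fps_conv_radius (neg_ln_power_fps n * ?q)"
    using less_conv_radius_neg_ln_power_fps[OF t] conv_q
    by (intro less_le_trans[OF _ fps_conv_radius_mult]) simp
  then have "(\<lambda>N. (neg_ln_power_fps n * ?q) $ N * t ^ N) sums eval_fps (neg_ln_power_fps n * ?q) t"
    by (intro sums_eval_fps) simp
  moreover have "eval_fps ?q t = 1 / (1 - t)"
    using q[OF t] by (simp add: eval_fps_def sums_iff)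
  then have "eval_fps (neg_ln_power_fps n * ?q) t = (- ln (1 - t)) ^ n / fact n / (1 - t)"
    by (simp add: eval_fps_mult less_conv_radius_neg_ln_power_fps eval_neg_ln_power_fps t conv_q)
  ultimately show ?thesis
    by (simp flip: harm_fps_gf)
qed

lemma harm_fps_integral_sums:
  assumes t: "\<bar>t\<bar> < 1"
  shows "(\<lambda>N. harm_fps N $ n / real (Suc N) * t ^ Suc N)
    sums ((- ln (1 - t)) ^ Suc n / fact (Suc n))"
proof -
  let ?P = "neg_ln_power_fps (Suc n)"
  have "(\<lambda>N. ?P $ N * t ^ N) sums ((- ln (1 - t)) ^ Suc n / fact (Suc n))"
    unfolding eval_neg_ln_power_fps[OF t, symmetric]
    by (intro sums_eval_fps) (simp add: less_conv_radius_neg_ln_power_fps t)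
  then have "(\<lambda>N. ?P $ Suc N * t ^ Suc N) sums ((- ln (1 - t)) ^ Suc n / fact (Suc n))"
    by (subst sums_Suc_iff) (simp add: neg_ln_power_fps_nth_0)
  moreover have "real (Suc N) * ?P $ Suc N = harm_fps N $ n" for N
    using arg_cong[OF fps_deriv_neg_ln_power_fps[of n, folded harm_fps_gf], of "\<lambda>f. f $ N"] by simp
  then have "?P $ Suc N = harm_fps N $ n / real (Suc N)" for N
    by (simp add: field_simps del: of_nat_Suc)
  ultimately show ?thesis by simp
qed

lemma poly_A_exp_Ty_nth:
  "poly (A_exp_Ty $ n) T = (\<Sum>j=0..n. A_fps $ j * (T ^ (n - j) / fact (n - j)))"
  by (simp add: A_exp_Ty_def exp_Ty_def fps_mult_nth poly_sum poly_monom)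

lemma A_harm_fps_sums:
  assumes "\<bar>t\<bar> < 1"
  shows "(\<lambda>N. A_harm_fps N $ n * t ^ N) sums (poly (A_exp_Ty $ n) (- ln (1 - t)) / (1 - t))"
proof -
  have "(\<lambda>N. \<Sum>j=0..n. A_fps $ j * (harm_fps N $ (n - j) * t ^ N)) sums
      (\<Sum>j=0..n. A_fps $ j * ((- ln (1 - t)) ^ (n - j) / fact (n - j) / (1 - t)))"
    by (intro sums_sum sums_mult harm_fps_sums assms)
  then show ?thesis
    by (simp add: poly_A_exp_Ty_nth A_harm_fps_nth sum_distrib_right sum_divide_distrib mult.assoc)
qed

lemma A_harm_fps_integral_sums:
  "\<exists>R. \<forall>t. \<bar>t\<bar> < 1 \<longrightarrow>
    (\<lambda>N. A_harm_fps N $ n / real (Suc N) * t ^ Suc N) sums poly R (- ln (1 - t))"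
proof (intro exI allI impI)
  fix t :: real assume "\<bar>t\<bar> < 1"
  then have "(\<lambda>N. \<Sum>j=0..n. A_fps $ j * (harm_fps N $ (n - j) / real (Suc N) * t ^ Suc N)) sums
      (\<Sum>j=0..n. A_fps $ j * ((- ln (1 - t)) ^ Suc (n - j) / fact (Suc (n - j))))"
    by (intro sums_sum sums_mult harm_fps_integral_sums)
  then show "(\<lambda>N. A_harm_fps N $ n / real (Suc N) * t ^ Suc N) sums
      poly (\<Sum>j=0..n. monom (A_fps $ j / fact (Suc (n - j))) (Suc (n - j))) (- ln (1 - t))"
    by (simp add: A_harm_fps_nth sum_distrib_right sum_divide_distrib poly_sum poly_monom mult.assoc
        del: power_Suc fact_Suc of_nat_Suc)
qed

lemma A_harm_fps_asymp_equiv: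
  "(\<lambda>N. A_harm_fps N $ n) \<sim>[sequentially] (\<lambda>N. ln (real N) ^ n / fact n)"
proof -
  define l where "l = (\<lambda>N. ln (real N) + euler_mascheroni)"
  obtain p where "(\<lambda>N. A_harm_fps N $ n - l N ^ n / fact n) \<in> O(\<lambda>N. 1 / real N * ln (real N) ^ p)"
    using A_harm_fps_expansion[of n] unfolding seq.soft_bigo_def l_def by blast
  also have "(\<lambda>N. 1 / real N * ln (real N) ^ p) \<in> o(\<lambda>N. l N ^ n / fact n)"
    unfolding l_def by real_asymp
  finally have "(\<lambda>N. A_harm_fps N $ n) \<sim>[sequentially] (\<lambda>N. l N ^ n / fact n)"
    by (rule smallo_imp_asymp_equiv)
  also have "l \<sim>[sequentially] (\<lambda>N. ln (real N))" unfolding l_def by real_asymp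
  then have "(\<lambda>N. l N ^ n / fact n) \<sim>[sequentially] (\<lambda>N. ln (real N) ^ n / fact n)"
    by (intro asymp_equiv_intros)
  finally show ?thesis .
qed

section \<open>Abel means\<close>

definition abel_mean :: "(nat \<Rightarrow> real) \<Rightarrow> real \<Rightarrow> real" where
  "abel_mean f t = (1 - t) * (\<Sum>n. f n * t ^ n)"

lemma abel_mean_diff:
  assumes "summable (\<lambda>n. f n * t ^ n)" "summable (\<lambda>n. g n * t ^ n)"
  shows "abel_mean (\<lambda>n. f n - g n) t = abel_mean f t - abel_mean g t"
  using suminf_diff[OF assms, symmetric]
  by (simp add: abel_mean_def left_diff_distrib[of _ _ "t ^ _"] right_diff_distrib)

lemma abel_summation_by_parts:
  assumes "summable (\<lambda>n. f n * t ^ n)"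
  shows "(\<lambda>n. (f (Suc n) - f n) * t ^ Suc n) sums (abel_mean f t - f 0)"
proof -
  have sums: "(\<lambda>n. f n * t ^ n) sums (\<Sum>n. f n * t ^ n)"
    using assms by (rule summable_sums)
  then have "(\<lambda>n. f (Suc n) * t ^ Suc n) sums ((\<Sum>n. f n * t ^ n) - f 0)"
    by (subst sums_Suc_iff) simp
  from sums_diff[OF this sums_mult[OF sums, of t]] show ?thesis
    by (simp add: abel_mean_def algebra_simps)
qed

lemma bigo_sequentially_imp_le_plus_finite:
  fixes f g :: "nat \<Rightarrow> real"
  assumes "f \<in> O(g)" "\<forall>\<^sub>F n in sequentially. g n \<ge> 0"
  obtains C h K where "\<And>n. \<bar>f n\<bar> \<le> C * g n + h n" "\<And>n. n \<ge> K \<Longrightarrow> h n = 0" "\<And>n. h n \<ge> 0"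
proof -
  obtain C where "\<forall>\<^sub>F n in sequentially. norm (f n) \<le> C * norm (g n)"
    using assms(1) by (rule landau_o.bigE)
  with assms(2) have "\<forall>\<^sub>F n in sequentially. \<bar>f n\<bar> \<le> C * g n"
    by eventually_elim simp
  then obtain K where "\<And>n. n \<ge> K \<Longrightarrow> \<bar>f n\<bar> \<le> C * g n"
    by (auto simp: eventually_sequentially)
  then show ?thesis
    by (intro that[of C "\<lambda>n. if n < K then \<bar>f n\<bar> + \<bar>C * g n\<bar> else 0" K]) auto
qed

lemma power_series_bigo:
  fixes f g :: "nat \<Rightarrow> real"
  assumes "f \<in> O(g)" "\<forall>\<^sub>F n in sequentially. g n \<ge> 0"
    and summable: "\<And>t. 0 \<le> t \<Longrightarrow> t < 1 \<Longrightarrow> summable (\<lambda>n. g n * t ^ n)"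
  obtains C D where "\<And>t. 0 \<le> t \<Longrightarrow> t < 1 \<Longrightarrow> summable (\<lambda>n. f n * t ^ n)"
    "\<And>t. 0 \<le> t \<Longrightarrow> t < 1 \<Longrightarrow> \<bar>\<Sum>n. f n * t ^ n\<bar> \<le> C * (\<Sum>n. g n * t ^ n) + D"
proof -
  obtain C h K where f_le: "\<And>n. \<bar>f n\<bar> \<le> C * g n + h n"
    and h_eq_0: "\<And>n. n \<ge> K \<Longrightarrow> h n = 0" and h_nonneg: "\<And>n. h n \<ge> 0"
    using bigo_sequentially_imp_le_plus_finite[OF assms(1,2)] by blast
  have term_le: "norm (f n * t ^ n) \<le> C * (g n * t ^ n) + h n * t ^ n" if "0 \<le> t" for n t
    using mult_right_mono[OF f_le[of n], of "t ^ n"] that by (simp add: abs_mult algebra_simps)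
  have majorant_sums: "(\<lambda>n. C * (g n * t ^ n) + h n * t ^ n) sums
      (C * (\<Sum>n. g n * t ^ n) + (\<Sum>n<K. h n * t ^ n))" if "0 \<le> t" "t < 1" for t
    by (intro sums_add sums_mult summable_sums summable sums_finite that) (auto simp: h_eq_0)
  show ?thesis
  proof (rule that[of C "\<Sum>n<K. h n"])
    fix t :: real assume t: "0 \<le> t" "t < 1"
    note majorant = sums_summable[OF majorant_sums[OF t]]
    show "summable (\<lambda>n. f n * t ^ n)"
      using term_le[OF t(1)] majorant by (auto intro: summable_comparison_test')
    have "\<bar>\<Sum>n. f n * t ^ n\<bar> \<le> C * (\<Sum>n. g n * t ^ n) + (\<Sum>n<K. h n * t ^ n)"
      using norm_suminf_le[OF term_le[OF t(1)] majorant] majorant_sums[OF t]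
      by (simp add: sums_iff)
    also have "(\<Sum>n<K. h n * t ^ n) \<le> (\<Sum>n<K. h n)"
      using t by (intro sum_mono mult_right_le_one_le power_le_one) (auto simp: h_nonneg)
    finally show "\<bar>\<Sum>n. f n * t ^ n\<bar> \<le> C * (\<Sum>n. g n * t ^ n) + (\<Sum>n<K. h n)"
      by simp
  qed
qed

lemma soft_bigo_imp_harmonic_majorant:
  assumes "f \<in> seq.soft_bigo (\<lambda>N. 1 / real N)"
  obtains g R where "f \<in> O(g)" "\<forall>\<^sub>F N in sequentially. g N \<ge> 0"
    "\<And>t. \<bar>t\<bar> < 1 \<Longrightarrow> (\<lambda>N. g N * t ^ Suc N) sums poly R (- ln (1 - t))"
proof -
  obtain p where p: "f \<in> O(\<lambda>N. 1 / real N * ln (real N) ^ p)"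
    using assms unfolding seq.soft_bigo_def by blast
  define g where "g = (\<lambda>N. A_harm_fps N $ p / real (Suc N))"
  have g_equiv: "g \<sim>[sequentially] (\<lambda>N. ln (real N) ^ p / fact p / real (Suc N))"
    unfolding g_def by (intro asymp_equiv_intros A_harm_fps_asymp_equiv)
  have "(\<lambda>N. 1 / real N * ln (real N) ^ p) \<in> O(\<lambda>N. ln (real N) ^ p / fact p / real (Suc N))"
    by real_asymp
  also have "(\<lambda>N. ln (real N) ^ p / fact p / real (Suc N)) \<in> O(g)"
    by (rule bigthetaD1[OF asymp_equiv_imp_bigtheta[OF asymp_equiv_symI[OF g_equiv]]])
  finally have "f \<in> O(g)" by (rule landau_o.big_trans[OF p])
  moreover have "\<forall>\<^sub>F N in sequentially. ln (real N) ^ p / fact p / real (Suc N) > 0"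
    by real_asymp
  with asymp_equiv_eventually_pos_iff[OF g_equiv] have "\<forall>\<^sub>F N in sequentially. g N \<ge> 0"
    by eventually_elim simp
  ultimately show ?thesis
    using A_harm_fps_integral_sums[of p] that unfolding g_def by blast
qed

lemma power_series_soft_bigo:
  assumes "f \<in> seq.soft_bigo (\<lambda>N. 1 / real N)"
  obtains Q where "\<And>t. 0 \<le> t \<Longrightarrow> t < 1 \<Longrightarrow> summable (\<lambda>n. f n * t ^ n)"
    "\<And>t. 0 < t \<Longrightarrow> t < 1 \<Longrightarrow> \<bar>\<Sum>n. f n * t ^ n\<bar> \<le> 1 / t * poly Q (- ln (1 - t))"
proof -
  obtain g R where g: "f \<in> O(g)" "\<forall>\<^sub>F N in sequentially. g N \<ge> 0"
    and R: "\<And>t. \<bar>t\<bar> < 1 \<Longrightarrow> (\<lambda>N. g N * t ^ Suc N) sums poly R (- ln (1 - t))"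
    using soft_bigo_imp_harmonic_majorant[OF assms] by blast
  have g_sums: "(\<lambda>N. g N * t ^ N) sums (1 / t * poly R (- ln (1 - t)))" if "0 < t" "t < 1" for t
    using sums_mult[OF R[of t], of "1 / t"] that by (simp add: mult_ac)
  have g_summable: "summable (\<lambda>N. g N * t ^ N)" if "0 \<le> t" "t < 1" for t
    using sums_summable[OF g_sums[of t]] that by (cases "t = 0") auto
  obtain C D where f_summable: "\<And>t. 0 \<le> t \<Longrightarrow> t < 1 \<Longrightarrow> summable (\<lambda>n. f n * t ^ n)"
    and f_le: "\<And>t. 0 \<le> t \<Longrightarrow> t < 1 \<Longrightarrow> \<bar>\<Sum>n. f n * t ^ n\<bar> \<le> C * (\<Sum>N. g N * t ^ N) + D"
    using power_series_bigo[OF g g_summable] by blast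
  show ?thesis
  proof (rule that[OF f_summable])
    fix t :: real assume t: "0 < t" "t < 1"
    have "\<bar>\<Sum>n. f n * t ^ n\<bar> \<le> C * (1 / t * poly R (- ln (1 - t))) + D"
      using f_le[of t] g_sums[OF t] t by (simp add: sums_iff)
    also have "D \<le> 1 / t * \<bar>D\<bar>"
      using t mult_right_mono[of 1 "1 / t" "\<bar>D\<bar>"] by simp
    finally show "\<bar>\<Sum>n. f n * t ^ n\<bar> \<le> 1 / t * poly (smult C R + [:\<bar>D\<bar>:]) (- ln (1 - t))"
      by (simp add: algebra_simps)
  qed
qed

lemma summable_power_series_if_soft_bigo:
  assumes "f \<in> seq.soft_bigo (\<lambda>N. 1 / real N)" "0 \<le> t" "t < 1"
  shows "summable (\<lambda>n. f n * t ^ n)"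
  by (rule power_series_soft_bigo[OF assms(1)]) (use assms(2,3) in blast)

lemma abel_mean_soft_bigo:
  assumes "f \<in> seq.soft_bigo (\<lambda>N. 1 / real N)"
  shows "abel_mean f \<in> left.soft_bigo (\<lambda>t. 1 - t)"
proof -
  obtain Q where
    Q: "\<And>t. 0 < t \<Longrightarrow> t < 1 \<Longrightarrow> \<bar>\<Sum>n. f n * t ^ n\<bar> \<le> 1 / t * poly Q (- ln (1 - t))"
    by (rule power_series_soft_bigo[OF assms]) blast
  have "(\<lambda>t. \<Sum>n. f n * t ^ n) \<in> O[at_left 1](\<lambda>t. 1 / t * poly Q (- ln (1 - t)))"
  proof (rule bigoI[of _ 1], use eventually_at_left_1_in_unit_interval in eventually_elim)
    case (elim t)
    then show ?case
      unfolding real_norm_def mult_1 by (intro order_trans[OF Q abs_ge_self]) auto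
  qed
  moreover have "(\<lambda>t::real. 1 / t) \<in> O[at_left 1](\<lambda>_. 1)" by real_asymp
  then have "(\<lambda>t. 1 / t * poly Q (- ln (1 - t))) \<in> left.soft_bigo (\<lambda>_. 1)"
    by (intro left.bigo_mult_soft_bigo_1 left.soft_bigo_poly neg_ln_in_soft_bigo)
  ultimately have "(\<lambda>t. \<Sum>n. f n * t ^ n) \<in> left.soft_bigo (\<lambda>_. 1)"
    by (rule left.bigo_soft_bigo_trans)
  then show ?thesis
    unfolding abel_mean_def[abs_def] by (intro left.bigo_mult_soft_bigo_1) simp_all
qed

definition harm_poly :: "real poly \<Rightarrow> nat \<Rightarrow> real" where
  "harm_poly W N = (\<Sum>n\<le>degree W. coeff W n * fact n * A_harm_fps N $ n)"

lemma harm_poly_expansion: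
  "(\<lambda>N. harm_poly W N - poly W (ln (real N) + euler_mascheroni)) \<in> seq.soft_bigo (\<lambda>N. 1 / real N)"
proof -
  define l where "l = (\<lambda>N. ln (real N) + euler_mascheroni)"
  have "(\<lambda>N. \<Sum>n\<le>degree W. coeff W n * fact n * (A_harm_fps N $ n - l N ^ n / fact n))
      \<in> seq.soft_bigo (\<lambda>N. 1 / real N)"
    unfolding l_def by (intro seq.soft_bigo_sum seq.soft_bigo_cmult A_harm_fps_expansion)
  then show ?thesis
    by (simp add: harm_poly_def l_def poly_altdef right_diff_distrib sum_subtractf)
qed

lemma harm_poly_sums:
  assumes "\<bar>t\<bar> < 1"
  shows "(\<lambda>N. harm_poly W N * t ^ N) sums (poly (rho W) (- ln (1 - t)) / (1 - t))"
proof -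
  have "(\<lambda>N. \<Sum>n\<le>degree W. coeff W n * fact n * (A_harm_fps N $ n * t ^ N)) sums
      (\<Sum>n\<le>degree W. coeff W n * fact n * (poly (A_exp_Ty $ n) (- ln (1 - t)) / (1 - t)))"
    by (intro sums_sum sums_mult A_harm_fps_sums assms)
  then show ?thesis
    by (simp add: harm_poly_def rho_def poly_sum sum_distrib_right sum_divide_distrib mult.assoc)
qed

lemma minus_harm_poly_soft_bigo:
  assumes "(\<lambda>N. f N - poly W (ln (real N) + euler_mascheroni)) \<in> seq.soft_bigo (\<lambda>N. 1 / real N)"
  shows "(\<lambda>N. f N - harm_poly W N) \<in> seq.soft_bigo (\<lambda>N. 1 / real N)"
  using seq.soft_bigo_diff[OF assms harm_poly_expansion[of W]] by simp

lemma summable_power_series_if_poly_expansion: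
  assumes "(\<lambda>N. f N - poly W (ln (real N) + euler_mascheroni)) \<in> seq.soft_bigo (\<lambda>N. 1 / real N)"
    and "0 \<le> t" "t < 1"
  shows "summable (\<lambda>n. f n * t ^ n)"
proof -
  have "summable (\<lambda>n. (f n - harm_poly W n) * t ^ n)"
    by (rule summable_power_series_if_soft_bigo[OF minus_harm_poly_soft_bigo]) fact+
  moreover have "summable (\<lambda>n. harm_poly W n * t ^ n)"
    using assms(2,3) by (intro sums_summable[OF harm_poly_sums]) simp
  ultimately have "summable (\<lambda>n. (f n - harm_poly W n) * t ^ n + harm_poly W n * t ^ n)"
    by (rule summable_add)
  then show ?thesis by (simp add: algebra_simps)
qed

lemma abel_mean_expansion:
  assumes "(\<lambda>N. f N - poly W (ln (real N) + euler_mascheroni)) \<in> seq.soft_bigo (\<lambda>N. 1 / real N)"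
  shows "(\<lambda>t. abel_mean f t - poly (rho W) (- ln (1 - t))) \<in> left.soft_bigo (\<lambda>t. 1 - t)"
proof (rule left.soft_bigo_cong[OF abel_mean_soft_bigo[OF minus_harm_poly_soft_bigo[OF assms]]],
    use eventually_at_left_1_in_unit_interval in eventually_elim)
  case (elim t)
  have "abel_mean (\<lambda>N. f N - harm_poly W N) t = abel_mean f t - abel_mean (harm_poly W) t"
    using elim by (intro abel_mean_diff summable_power_series_if_poly_expansion[OF assms]
        sums_summable[OF harm_poly_sums]) auto
  also have "abel_mean (harm_poly W) t = poly (rho W) (- ln (1 - t))"
    using harm_poly_sums[of t W] elim by (simp add: abel_mean_def sums_iff)
  finally show ?case .
qed

section \<open>Comparison of the two regularisations\<close>

lemma Li_snoc:
  assumes x: "x > -1"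
    and sums: "((\<lambda>n. t powr (real n + x) * (zeta_trunc x ks n / (real n + x) ^ k))
      has_sum s) {0<..}"
  shows "Li x (ks @ [k]) t = s"
proof -
  define \<phi> where "\<phi> = (\<lambda>ms. t powr (real (last ms) + x) * mz_term x (ks @ [k]) ms)"
  have "(\<phi> has_sum s) (incr_tuples (Suc (length ks)) {0<..})"
  proof (rule has_sum_incr_tuples_snoc)
    show "\<phi> ms \<ge> 0" if "ms \<in> incr_tuples (Suc (length ks)) {0<..}" for ms
      using that x by (auto simp: \<phi>_def intro!: mult_nonneg_nonneg mz_term_nonneg)
    have "{0<..} \<inter> {..<n} = {0<..<n}" for n :: nat by auto
    then show "((\<lambda>n. \<Sum>ms\<in>incr_tuples (length ks) ({0<..} \<inter> {..<n}). \<phi> (ms @ [n])) has_sum s) {0<..}"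
      using sums by (simp add: \<phi>_def sum_mz_term_snoc flip: sum_distrib_left)
  qed
  then show ?thesis by (simp add: Li_def \<phi>_def infsumI)
qed

lemma Li_snoc_eq_abel_mean:
  assumes x: "x > -1" and t: "t > 0"
    and summable: "summable (\<lambda>n. zeta_trunc x (ks @ [k]) n * t ^ n)"
  shows "Li x (ks @ [k]) t = t powr (x - 1) * abel_mean (zeta_trunc x (ks @ [k])) t"
proof (rule Li_snoc[OF x])
  let ?Z = "zeta_trunc x (ks @ [k])"
  define s where "s = t powr (x - 1) * abel_mean ?Z t"
  define \<phi> where "\<phi> = (\<lambda>n. t powr (x - 1) * ((?Z (Suc n) - ?Z n) * t ^ Suc n))"
  have \<phi>_0: "\<phi> 0 = 0"
  proof -
    have "{0<..<Suc 0} = {}" by auto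
    then show ?thesis by (simp add: \<phi>_def zeta_trunc_snoc)
  qed
  have \<phi>: "\<phi> n = t powr (real n + x) * (zeta_trunc x ks n / (real n + x) ^ k)" if "n \<in> {0<..}" for n
  proof -
    have "t powr (x - 1) * t ^ Suc n = t powr (x - 1 + real (Suc n))"
      using t by (simp only: powr_add powr_realpow)
    then show ?thesis
      using that zeta_trunc_snoc_diff[of n x ks k] by (simp add: \<phi>_def mult_ac add.commute)
  qed
  have "\<phi> sums (t powr (x - 1) * (abel_mean ?Z t - ?Z 0))"
    unfolding \<phi>_def by (intro sums_mult abel_summation_by_parts summable)
  then have "\<phi> sums s" by (simp add: s_def zeta_trunc_snoc)
  moreover have "\<phi> n \<ge> 0" for n
    using \<phi>[of n] \<phi>_0 x zeta_trunc_nonneg[of x ks n] by (cases "n = 0") auto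
  ultimately have "(\<phi> has_sum s) UNIV" by (rule sums_nonneg_imp_has_sum)
  also have "(\<phi> has_sum s) UNIV \<longleftrightarrow> (\<phi> has_sum s) {0<..}"
    using \<phi>_0 by (intro has_sum_cong_neutral) auto
  also have "\<dots> \<longleftrightarrow>
      ((\<lambda>n. t powr (real n + x) * (zeta_trunc x ks n / (real n + x) ^ k)) has_sum s) {0<..}"
    using \<phi> by (intro has_sum_cong) auto
  finally show "((\<lambda>n. t powr (real n + x) * (zeta_trunc x ks n / (real n + x) ^ k))
      has_sum t powr (x - 1) * abel_mean ?Z t) {0<..}"
    by (simp only: s_def)
qed

lemma Li_eq_abel_mean:
  assumes "x > -1" "0 < t" "t < 1" "summable (\<lambda>n. zeta_trunc x ks n * t ^ n)"
  shows "Li x ks t = (if ks = [] then 1 else t powr (x - 1)) * abel_mean (zeta_trunc x ks) t"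
proof (cases ks rule: rev_cases)
  case Nil
  then show ?thesis
    using assms(2,3) by (simp add: Li_def abel_mean_def suminf_geometric)
next
  case (snoc ks' k)
  then show ?thesis
    using Li_snoc_eq_abel_mean[OF assms(1,2), of ks' k] assms(4) by simp
qed

lemma Li_expansion:
  assumes x: "x > -1"
    and W: "(\<lambda>N. zeta_trunc x ks N - poly W (ln (real N) + euler_mascheroni))
      \<in> seq.soft_bigo (\<lambda>N. 1 / real N)"
  shows "(\<lambda>t. Li x ks t - poly (rho W) (- ln (1 - t))) \<in> left.soft_bigo (\<lambda>t. 1 - t)"
proof -
  define a where "a = abel_mean (zeta_trunc x ks)"
  define c where "c = (\<lambda>t. if ks = [] then 1 else t powr (x - 1))"
  have a: "(\<lambda>t. a t - poly (rho W) (- ln (1 - t))) \<in> left.soft_bigo (\<lambda>t. 1 - t)"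
    unfolding a_def by (rule abel_mean_expansion[OF W])
  have "(\<lambda>t::real. t powr (x - 1) - 1) \<in> O[at_left 1](\<lambda>t. 1 - t)" by real_asymp
  then have c: "(\<lambda>t. c t - 1) \<in> O[at_left 1](\<lambda>t. 1 - t)"
    by (cases "ks = []") (simp_all add: c_def)
  have "(\<lambda>t::real. 1 - t) \<in> O[at_left 1](\<lambda>_. 1)" by real_asymp
  then have "a \<in> left.soft_bigo (\<lambda>_. 1)"
    by (rule left.soft_bigo_1_if_poly_expansion[OF a _ neg_ln_in_soft_bigo])
  from left.soft_bigo_add[OF left.bigo_mult_soft_bigo_1[OF c this] a] show ?thesis
  proof (rule left.soft_bigo_cong, use eventually_at_left_1_in_unit_interval in eventually_elim)
    case (elim t)
    then have "Li x ks t = c t * a t"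
      unfolding a_def c_def
      by (intro Li_eq_abel_mean summable_power_series_if_poly_expansion[OF W] x) auto
    then show ?case by (simp add: algebra_simps)
  qed
qed

lemma tendsto_one_minus_mult_ln_power:
  "((\<lambda>t::real. (1 - t) * ln (1 - t) ^ p) \<longlongrightarrow> 0) (at_left 1)"
proof -
  have "((\<lambda>u::real. (- 1) ^ p * (ln u ^ p / u)) \<longlongrightarrow> 0) at_top"
    by (rule tendsto_mult_right_zero) real_asymp
  moreover have "filterlim (\<lambda>t::real. 1 / (1 - t)) at_top (at_left 1)" by real_asymp
  ultimately have "((\<lambda>t::real. (- 1) ^ p * (ln (1 / (1 - t)) ^ p / (1 / (1 - t)))) \<longlongrightarrow> 0) (at_left 1)"
    by (rule filterlim_compose)
  then show ?thesis
  proof (rule Lim_transform_eventually,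
      use eventually_at_left_1_in_unit_interval in eventually_elim)
    case (elim t)
    have "ln (1 / (1 - t)) = - ln (1 - t)" using elim by (simp add: ln_div)
    moreover have "(- 1) ^ p * (- ln (1 - t)) ^ p = ln (1 - t) ^ p"
      by (simp flip: power_mult_distrib)
    ultimately show ?case by simp
  qed
qed

lemma Zstar_eqI:
  assumes "(\<lambda>N. zeta_trunc x ks N - poly Q (ln (real N) - Digamma (1 + x)))
    \<in> seq.soft_bigo (\<lambda>N. 1 / real N)"
  shows "Zstar x ks = Q"
proof -
  have "Zstar x ks = (THE Q. (\<lambda>N. zeta_trunc x ks N - poly Q (ln (real N) - Digamma (1 + x)))
      \<in> seq.soft_bigo (\<lambda>N. 1 / real N))"
    by (simp add: Zstar_def seq.soft_bigo_iff_pos_power)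
  also have "\<dots> = Q"
  proof (rule seq.the_poly_expansion[OF _ _ assms])
    show "(\<lambda>N. 1 / real N * ln (real N) ^ p) \<longlonglongrightarrow> 0" for p by real_asymp
    show "filterlim (\<lambda>N. ln (real N) - Digamma (1 + x)) at_infinity sequentially" by real_asymp
  qed
  finally show ?thesis .
qed

lemma Ppoly_eqI:
  assumes "(\<lambda>t. Li x ks t - poly Q (- ln (1 - t))) \<in> left.soft_bigo (\<lambda>t. 1 - t)"
  shows "Ppoly x ks = Q"
proof -
  have "Ppoly x ks = (THE Q. (\<lambda>t. Li x ks t - poly Q (- ln (1 - t))) \<in> left.soft_bigo (\<lambda>t. 1 - t))"
    by (simp add: Ppoly_def left.soft_bigo_iff_pos_power)
  also have "\<dots> = Q"
  proof (rule left.the_poly_expansion[OF tendsto_one_minus_mult_ln_power _ assms])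
    show "filterlim (\<lambda>t::real. - ln (1 - t)) at_infinity (at_left 1)" by real_asymp
  qed
  finally show ?thesis .
qed

theorem theorem2p2:
  fixes x :: real and ks :: "nat list"
  assumes "\<bar>x\<bar> < 1" and "\<forall>k\<in>set ks. k > 0"
  shows "Ppoly x ks = rho (pcompose (Zstar x ks) [:- euler_mascheroni - Digamma (1 + x), 1:])"
proof -
  obtain Q where
    Q: "(\<lambda>N. zeta_trunc x ks N - poly Q (ln (real N))) \<in> seq.soft_bigo (\<lambda>N. 1 / real N)"
    using zeta_trunc_expansion[OF assms(2)] by blast
  have "Zstar x ks = pcompose Q [:Digamma (1 + x), 1:]"
    by (rule Zstar_eqI) (use Q in \<open>simp add: poly_pcompose\<close>)
  then have "(\<lambda>N. zeta_trunc x ks N -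
      poly (pcompose (Zstar x ks) [:- euler_mascheroni - Digamma (1 + x), 1:])
        (ln (real N) + euler_mascheroni)) \<in> seq.soft_bigo (\<lambda>N. 1 / real N)"
    using Q by (simp add: poly_pcompose)
  with assms(1) show ?thesis
    by (intro Ppoly_eqI Li_expansion) simp_all
qed

end
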